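(* Let $k\ge 2$ be an integer and let $G$ be an $(X,Y,a,b)$-graph with $a\ge k$ and $b\ge k$. Let $\lambda_2$ be the second largest eigenvalue of the adjacency matrix of $G$. If $$\lambda_2\le \sqrt{ab} -\frac{(k-1)\max\{a,b\}}{2\sqrt{ab - (k-1)\max\{a,b\}}},$$ then $\kappa(G)\ge k$.
   Context: All graphs are finite and simple. An $(X,Y,a,b)$-graph is a bipartite graph with bipartition $(X,Y)$ ($X,Y$ nonempty, $a,b$ positive integers) in which every vertex of $X$ has degree $a$ and every vertex of $Y$ has degree $b$ (so $a|X|=b|Y|$); it is not assumed connected. The eigenvalues of the adjacency matrix of $G$ on $n$ vertices are ordered $\lambda_1\ge\lambda_2\ge\cdots\ge\lambda_n$, counted with multiplicity. The vertex connectivity $\kappa(G)$ is the minimum number of vertices whose removal produces a disconnected graph; $\kappa(G)\ge k$ means that $G$ is $k$-connected. *)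

theory Defs
  imports
    Complex_Main
    "Graph_Theory.Digraph_Component"
    "Jordan_Normal_Form.Char_Poly"
begin

text \<open>
  Finite simple graphs are the symmetric, loop-free digraphs without multiple arcs of the
  locale \<^locale>\<open>graph\<close>. Each undirected edge is represented by two opposite arcs, so the degree
  of a vertex is its \<^const>\<open>out_degree\<close>.
\<close>

definition biregular_graph ::
    "('v, 'e) pre_digraph \<Rightarrow> 'v set \<Rightarrow> 'v set \<Rightarrow> nat \<Rightarrow> nat \<Rightarrow> bool" where
  "biregular_graph G X Y a b \<longleftrightarrow>
     graph G \<and>
     X \<noteq> {} \<and> Y \<noteq> {} \<and> X \<inter> Y = {} \<and> X \<union> Y = verts G \<and>
     (\<forall>u v. u \<rightarrow>\<^bsub>G\<^esub> v \<longrightarrow> (u \<in> X \<and> v \<in> Y) \<or> (u \<in> Y \<and> v \<in> X)) \<and>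
     a > 0 \<and> b > 0 \<and>
     (\<forall>x\<in>X. out_degree G x = a) \<and>
     (\<forall>y\<in>Y. out_degree G y = b)"

definition adjacency_matrix :: "('v, 'e) pre_digraph \<Rightarrow> 'v list \<Rightarrow> real mat" where
  "adjacency_matrix G vs =
     mat (length vs) (length vs) (\<lambda>(i, j). if vs ! i \<rightarrow>\<^bsub>G\<^esub> vs ! j then 1 else 0)"

text \<open>
  The eigenvalues in non-increasing order, repeated according to multiplicity. A different
  enumeration of the vertices conjugates the adjacency matrix by a permutation matrix, so the
  result does not depend on the one chosen. As the matrix is real symmetric, its characteristic
  polynomial splits over the reals and no eigenvalue is missing from \<^const>\<open>proots\<close>.
\<close>

definition adjacency_eigenvalues :: "('v, 'e) pre_digraph \<Rightarrow> real list" where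
  "adjacency_eigenvalues G =
     (let vs = (SOME vs. distinct vs \<and> set vs = verts G)
      in rev (sorted_list_of_multiset (proots (char_poly (adjacency_matrix G vs)))))"

text \<open>Indexed from 1, so that \<open>adjacency_eigenvalue G 1\<close> is the largest eigenvalue.\<close>

definition adjacency_eigenvalue :: "('v, 'e) pre_digraph \<Rightarrow> nat \<Rightarrow> real" where
  "adjacency_eigenvalue G i = adjacency_eigenvalues G ! (i - 1)"

text \<open>
  A separating set leaves at least one vertex: the null graph counts neither as connected nor as
  disconnected, whereas \<^const>\<open>Digraph_Component.connected\<close> is false for it.
\<close>

definition separating_set :: "('v, 'e) pre_digraph \<Rightarrow> 'v set \<Rightarrow> bool" where
  "separating_set G S \<longleftrightarrow>
     S \<subset> verts G \<and> \<not> Digraph_Component.connected (G \<restriction> (verts G - S))"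

text \<open>
  Complete graphs are the only graphs without a separating set; for them the usual convention
  is that the vertex connectivity is one less than the number of vertices.
\<close>

definition vertex_connectivity :: "('v, 'e) pre_digraph \<Rightarrow> nat" where
  "vertex_connectivity G =
     (if \<exists>S. separating_set G S
      then LEAST n. \<exists>S. separating_set G S \<and> card S = n
      else card (verts G) - 1)"

end

theory Submission
  imports Defs
begin

text \<open>
  Suppose that a set \<open>S\<close> of fewer than \<open>k\<close> vertices separates \<open>G\<close>, and split the remaining vertices
  into nonempty sets \<open>A\<close> and \<open>B\<close> without edges between them. The largest eigenvalue \<open>sqrt (a * b)\<close> of
  \<open>G\<close> has the eigenvector \<open>z\<close> with value \<open>sqrt a\<close> on \<open>X\<close> and \<open>sqrt b\<close> on \<open>Y\<close>. The restrictions of \<open>z\<close>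
  to \<open>A\<close> and to \<open>B\<close> span a plane on which the Rayleigh quotient of the adjacency matrix is at least the
  smaller of the quotients of these two vectors, so the second eigenvalue is at least that large
  (\<open>second_adjacency_eigenvalue_gt_of_separated_sets\<close>). It remains to see that both quotients exceed
  the bound of the theorem (\<open>biregular_separated_part_rayleigh\<close>).

  Let \<open>e\<close> be the number of edges inside \<open>A\<close> and \<open>c = (k - 1) * max a b\<close>. The quotient at \<open>A\<close> is
  \<open>2 * sqrt (a * b) * e / w\<close> with \<open>w = a * |A \<inter> X| + b * |A \<inter> Y|\<close>. At most \<open>c\<close> edges leave \<open>S\<close>, which
  gives \<open>w \<le> 2 * e + c\<close>; and since all degrees are at least \<open>k\<close>, the set \<open>A\<close> is so large that
  \<open>e \<ge> a * b - c\<close> (\<open>biregular_separated_part\<close>). Hence the quotient is at least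
  \<open>sqrt (a * b) - c * sqrt (a * b) / (2 * a * b - c)\<close>, and the inequality of arithmetic and geometric
  means for \<open>a * b\<close> and \<open>a * b - c\<close> turns this into the required strict bound
  (\<open>rayleigh_bound_arith\<close>).

  The eigenvalues are given as roots of the characteristic polynomial, listed with multiplicity. The
  link with Rayleigh quotients is the spectral theorem for real symmetric matrices
  (\<open>symmetric_mat_orthogonally_diagonalisable\<close>), proved by deflation with Householder reflections.
\<close>

section \<open>Orthogonal diagonalisation of real symmetric matrices\<close>

lemma real_scalar_prod_self_pos:
  fixes v :: "real vec"
  assumes "v \<in> carrier_vec n" "v \<noteq> 0\<^sub>v n"
  shows "v \<bullet> v > 0"
proof -
  obtain i where "i < n" "v $ i \<noteq> 0" using assms by (auto simp: vec_eq_iff)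
  thus ?thesis using assms unfolding scalar_prod_def
    by (intro sum_pos2[of _ i]) (auto simp: zero_less_mult_iff)
qed

text \<open>
  Some complex eigenvalue \<open>c\<close> exists. For an eigenvector \<open>w\<close> of it, the number
  \<open>\<Sum>i j. cnj (w i) * A i j * w j\<close> equals \<open>c * \<Sum>i. (cmod (w i))\<^sup>2\<close>, and by symmetry of \<open>A\<close> it is its
  own conjugate; hence \<open>c\<close> is real, and so a root of the real characteristic polynomial.
\<close>

lemma symmetric_mat_real_eigenvector:
  fixes A :: "real mat"
  assumes A: "A \<in> carrier_mat n n" and sym: "transpose_mat A = A" and "n > 0"
  obtains r v where "v \<in> carrier_vec n" "v \<noteq> 0\<^sub>v n" "A *\<^sub>v v = r \<cdot>\<^sub>v v"
proof -
  let ?C = "map_mat complex_of_real A"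
  have C: "?C \<in> carrier_mat n n" using A by simp
  obtain as where as: "char_poly ?C = (\<Prod>a\<leftarrow>as. [:- a, 1:])" "length as = n"
    using char_poly_factorized[OF C] by auto
  with \<open>n > 0\<close> obtain c where "c \<in> set as" by (cases as) auto
  hence root: "poly (char_poly ?C) c = 0"
    unfolding as by (auto simp: poly_prod_list prod_list_zero_iff)
  hence "eigenvalue ?C c" using eigenvalue_root_char_poly[OF C] by simp
  then obtain w where w: "w \<in> carrier_vec n" "w \<noteq> 0\<^sub>v n" and ev: "?C *\<^sub>v w = c \<cdot>\<^sub>v w"
    using C unfolding eigenvalue_def eigenvector_def by auto
  define N where "N = (\<Sum>i<n. (cmod (w $ i))\<^sup>2)"
  define q where "q = (\<Sum>i<n. cnj (w $ i) * (\<Sum>j<n. of_real (A $$ (i,j)) * w $ j))"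
  have "w $ i \<noteq> 0 \<longrightarrow> i < n \<longrightarrow> N > 0" for i
    unfolding N_def by (auto intro!: sum_pos2[of _ i])
  moreover have "\<exists>i<n. w $ i \<noteq> 0" using w by (auto simp: vec_eq_iff)
  ultimately have N: "N > 0" by blast
  have "(\<Sum>j<n. of_real (A $$ (i,j)) * w $ j) = c * w $ i" if "i < n" for i
  proof -
    have "(?C *\<^sub>v w) $ i = (c \<cdot>\<^sub>v w) $ i" by (simp add: ev)
    thus ?thesis using that A w by (simp add: scalar_prod_def lessThan_atLeast0)
  qed
  hence "q = (\<Sum>i<n. c * of_real ((cmod (w $ i))\<^sup>2))"
    unfolding q_def by (intro sum.cong) (auto simp: complex_norm_square mult_ac simp del: of_real_power)
  also have "\<dots> = c * of_real N" by (simp add: N_def sum_distrib_left)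
  finally have q: "q = c * of_real N" .
  have symA: "A $$ (i,j) = A $$ (j,i)" if "i < n" "j < n" for i j
    using that A arg_cong[OF sym, of "\<lambda>M. M $$ (i,j)"] by simp
  have "cnj q = (\<Sum>i<n. \<Sum>j<n. w $ i * of_real (A $$ (i,j)) * cnj (w $ j))"
    unfolding q_def by (simp add: sum_distrib_left mult_ac)
  also have "\<dots> = (\<Sum>j<n. \<Sum>i<n. w $ i * of_real (A $$ (i,j)) * cnj (w $ j))"
    by (rule sum.swap)
  also have "\<dots> = q" unfolding q_def
    by (auto intro!: sum.cong simp: sum_distrib_left mult_ac symA)
  finally have "cnj c * of_real N = c * of_real N" unfolding q by simp
  hence "cnj c = c" using N by simp
  then obtain r where r: "c = of_real r" by (metis Reals_cnj_iff Reals_cases)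
  have "poly (char_poly ?C) c = of_real (poly (char_poly A) r)"
    unfolding r of_real_hom.char_poly_hom[OF A] by simp
  hence "poly (char_poly A) r = 0" using root by simp
  hence "eigenvalue A r" using eigenvalue_root_char_poly[OF A] by simp
  thus ?thesis using that A unfolding eigenvalue_def eigenvector_def by auto
qed

text \<open>
  The witness is the Householder reflection in the hyperplane orthogonal to \<open>u = v - e\<^sub>0\<close>, which
  exchanges the unit vectors \<open>v\<close> and \<open>e\<^sub>0\<close>. It serves in place of a completion of \<open>v\<close> to an
  orthonormal basis.
\<close>

lemma orthogonal_symmetric_mat_with_first_column:
  fixes v :: "real vec"
  assumes v: "v \<in> carrier_vec (Suc m)" and unit: "v \<bullet> v = 1"
  obtains H where "H \<in> carrier_mat (Suc m) (Suc m)" "transpose_mat H = H" "H * H = 1\<^sub>m (Suc m)"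
    "H *\<^sub>v unit_vec (Suc m) 0 = v"
proof -
  let ?n = "Suc m"
  define u where "u = v - unit_vec ?n 0"
  \<comment> \<open>For \<open>v = e\<^sub>0\<close> the division by zero yields \<open>c = 0\<close> and \<open>H\<close> is the identity, as it should be.\<close>
  define c where "c = 2 / (u \<bullet> u)"
  define H where "H = mat ?n ?n (\<lambda>(i,j). (if i = j then 1 else 0) - c * u $ i * u $ j)"
  have u: "u \<in> carrier_vec ?n" using v by (simp add: u_def)
  have uu: "u \<bullet> u = 2 - 2 * v $ 0"
  proof -
    have "u \<bullet> u = (\<Sum>i<?n. v $ i * v $ i - 2 * (if i = 0 then v $ 0 else 0) + (if i = 0 then 1 else 0))"
      using v unfolding u_def scalar_prod_def
      by (auto simp: lessThan_atLeast0 algebra_simps intro!: sum.cong)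
    also have "\<dots> = v \<bullet> v - 2 * v $ 0 + 1"
      using v by (simp add: sum.distrib sum_subtractf sum_distrib_left[symmetric] scalar_prod_def
          lessThan_atLeast0 del: sum.lessThan_Suc sum.op_ivl_Suc)
    finally show ?thesis by (simp add: unit)
  qed
  have cc: "c * c * (u \<bullet> u) = 2 * c" by (simp add: c_def)
  have H: "H \<in> carrier_mat ?n ?n" by (simp add: H_def)
  have 1: "transpose_mat H = H" by (rule eq_matI) (auto simp: H_def)
  have 2: "H * H = 1\<^sub>m ?n"
  proof (rule eq_matI; (simp add: H_def; fail)?)
    fix i j assume "i < dim_row (1\<^sub>m ?n :: real mat)" "j < dim_col (1\<^sub>m ?n :: real mat)"
    hence ij: "i < ?n" "j < ?n" by auto
    have "(H * H) $$ (i,j) = (\<Sum>k<?n. H $$ (i,k) * H $$ (k,j))"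
      using ij H by (simp add: scalar_prod_def lessThan_atLeast0 del: sum.op_ivl_Suc)
    also have "\<dots> = (\<Sum>k<?n. (if k = i then (if i = j then 1 else 0) - c * u $ i * u $ j else 0)
        - (if k = j then c * u $ i * u $ j else 0) + c * c * u $ i * u $ j * (u $ k * u $ k))"
      using ij by (intro sum.cong) (auto simp: H_def algebra_simps)
    also have "\<dots> = (if i = j then 1 else 0) - c * u $ i * u $ j - c * u $ i * u $ j
        + c * c * u $ i * u $ j * (u \<bullet> u)"
      using ij u by (simp add: sum.distrib sum_subtractf sum_distrib_left[symmetric] scalar_prod_def
          lessThan_atLeast0 del: sum.lessThan_Suc sum.op_ivl_Suc)
    also have "c * c * u $ i * u $ j * (u \<bullet> u) = (c * c * (u \<bullet> u)) * u $ i * u $ j"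
      by (simp add: mult_ac)
    finally show "(H * H) $$ (i,j) = 1\<^sub>m ?n $$ (i,j)" using ij unfolding cc by simp
  qed
  have 3: "H *\<^sub>v unit_vec ?n 0 = v"
  proof (rule eq_vecI)
    fix i assume "i < dim_vec v"
    hence i: "i < ?n" using v by auto
    have "(H *\<^sub>v unit_vec ?n 0) $ i = (if i = 0 then 1 else 0) - c * u $ i * u $ 0"
      using i H by (simp add: H_def)
    also have "\<dots> = (if i = 0 then 1 else 0) + u $ i"
    proof (cases "u \<bullet> u = 0")
      case True
      hence "u = 0\<^sub>v ?n" using real_scalar_prod_self_pos[OF u] by auto
      thus ?thesis using i by simp
    next
      case False
      have "u $ 0 = v $ 0 - 1" using v by (simp add: u_def)
      hence "u $ 0 = - (u \<bullet> u) / 2" by (simp add: uu)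
      hence "c * u $ 0 = -1" using False by (simp add: c_def)
      hence "c * u $ i * u $ 0 = - u $ i" by (metis mult.assoc mult.commute mult_minus1_right)
      thus ?thesis by simp
    qed
    also have "\<dots> = v $ i" using i v by (simp add: u_def)
    finally show "(H *\<^sub>v unit_vec ?n 0) $ i = v $ i" .
  qed (use H v in auto)
  show ?thesis using that[OF H 1 2 3] .
qed

text \<open>
  Induction on the dimension: conjugation by a reflection that takes \<open>e\<^sub>0\<close> to a unit eigenvector
  makes the first column of the matrix, and by symmetry its first row, vanish off the diagonal. What
  remains is a symmetric block of smaller size.
\<close>

lemma symmetric_mat_orthogonally_diagonalisable:
  fixes A :: "real mat"
  assumes "A \<in> carrier_mat n n" "transpose_mat A = A"
  shows "\<exists>P D. P \<in> carrier_mat n n \<and> D \<in> carrier_mat n n \<and> transpose_mat P * P = 1\<^sub>m n \<and>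
           transpose_mat P * A * P = D \<and> (\<forall>i<n. \<forall>j<n. i \<noteq> j \<longrightarrow> D $$ (i,j) = 0)"
  using assms
proof (induction n arbitrary: A)
  case 0
  show ?case
    by (rule exI[of _ "1\<^sub>m 0"], rule exI[of _ "0\<^sub>m 0 0"]) (use 0 in \<open>auto intro!: eq_matI\<close>)
next
  case (Suc m A)
  let ?n = "Suc m" and ?e = "unit_vec (Suc m) 0 :: real vec"
  note A = Suc.prems(1)
  obtain r v0 where v0: "v0 \<in> carrier_vec ?n" "v0 \<noteq> 0\<^sub>v ?n" "A *\<^sub>v v0 = r \<cdot>\<^sub>v v0"
    using symmetric_mat_real_eigenvector[OF Suc.prems zero_less_Suc] by metis
  define s where "s = sqrt (v0 \<bullet> v0)"
  define v where "v = (1 / s) \<cdot>\<^sub>v v0"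
  have s: "s > 0" "s * s = v0 \<bullet> v0"
    using real_scalar_prod_self_pos[OF v0(1,2)] by (auto simp: s_def)
  have v: "v \<in> carrier_vec ?n" using v0 by (simp add: v_def)
  have vv: "v \<bullet> v = 1" using v0 s by (simp add: v_def s(2)[symmetric])
  have Av: "A *\<^sub>v v = r \<cdot>\<^sub>v v"
    using v0 A by (simp add: v_def mult_mat_vec[of _ ?n ?n] smult_smult_assoc mult.commute)
  obtain H where H: "H \<in> carrier_mat ?n ?n" and Ht: "transpose_mat H = H"
    and HH: "H * H = 1\<^sub>m ?n" and He: "H *\<^sub>v ?e = v"
    using orthogonal_symmetric_mat_with_first_column[OF v vv] by metis
  define B where "B = H * A * H"
  have B: "B \<in> carrier_mat ?n ?n" using H A by (simp add: B_def)
  have "transpose_mat B = transpose_mat H * transpose_mat (H * A)"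
    unfolding B_def using H A by (intro transpose_mult[of _ ?n ?n _ ?n]) auto
  also have "transpose_mat (H * A) = transpose_mat A * transpose_mat H"
    using H A by (intro transpose_mult[of _ ?n ?n _ ?n]) auto
  also have "transpose_mat H * (transpose_mat A * transpose_mat H) = B"
    unfolding B_def using H A Ht Suc.prems(2) by (simp add: assoc_mult_mat[of _ ?n ?n _ ?n _ ?n])
  finally have Bt: "transpose_mat B = B" .
  have Be: "B *\<^sub>v ?e = r \<cdot>\<^sub>v ?e"
  proof -
    have Hv: "H *\<^sub>v v = ?e"
      unfolding He[symmetric] using H HH by (simp add: assoc_mult_mat_vec[symmetric, of _ ?n ?n _ ?n])
    have "B *\<^sub>v ?e = H *\<^sub>v (A *\<^sub>v (H *\<^sub>v ?e))"
      using H A unfolding B_def by (simp add: assoc_mult_mat_vec[of _ ?n ?n _ ?n])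
    thus ?thesis using He Av Hv v H by (simp add: mult_mat_vec[of _ ?n ?n])
  qed
  have col0: "B $$ (i,0) = (if i = 0 then r else 0)" if "i < ?n" for i
  proof -
    have "(B *\<^sub>v ?e) $ i = (r \<cdot>\<^sub>v ?e) $ i" by (simp add: Be)
    thus ?thesis using that B by auto
  qed
  have row0: "B $$ (0,i) = (if i = 0 then r else 0)" if "i < ?n" for i
    using that B col0[OF that] arg_cong[OF Bt, of "\<lambda>M. M $$ (i,0)"] by simp
  define B' where "B' = mat m m (\<lambda>(i,j). B $$ (Suc i, Suc j))"
  let ?R = "mat 1 1 (\<lambda>_. r)"
  have B': "B' \<in> carrier_mat m m" by (simp add: B'_def)
  have Bblock: "B = four_block_mat ?R (0\<^sub>m 1 m) (0\<^sub>m m 1) B'"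
    by (rule eq_matI) (use B col0 row0 in \<open>auto simp: B'_def\<close>)
  have "transpose_mat B' = B'"
  proof (rule eq_matI; (simp add: B'_def; fail)?)
    fix i j assume "i < dim_row B'" "j < dim_col B'"
    thus "transpose_mat B' $$ (i,j) = B' $$ (i,j)"
      using B arg_cong[OF Bt, of "\<lambda>M. M $$ (Suc i, Suc j)"] by (simp add: B'_def)
  qed
  from Suc.IH[OF B' this] obtain P' D' where P': "P' \<in> carrier_mat m m"
    and D': "D' \<in> carrier_mat m m" and P'P': "transpose_mat P' * P' = 1\<^sub>m m"
    and P'D': "transpose_mat P' * B' * P' = D'"
    and diag: "\<And>i j. i < m \<Longrightarrow> j < m \<Longrightarrow> i \<noteq> j \<Longrightarrow> D' $$ (i,j) = 0" by blast
  define Q where "Q = four_block_mat (1\<^sub>m 1) (0\<^sub>m 1 m) (0\<^sub>m m 1) P'"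
  define D where "D = four_block_mat ?R (0\<^sub>m 1 m) (0\<^sub>m m 1) D'"
  have Q: "Q \<in> carrier_mat ?n ?n" and D: "D \<in> carrier_mat ?n ?n"
    using P' D' by (auto simp: Q_def D_def)
  have Qt: "transpose_mat Q = four_block_mat (1\<^sub>m 1) (0\<^sub>m 1 m) (0\<^sub>m m 1) (transpose_mat P')"
    unfolding Q_def using P' by (subst transpose_four_block_mat[of _ 1 1 _ m _ m]) auto
  have QQ: "transpose_mat Q * Q = 1\<^sub>m ?n"
    unfolding Qt unfolding Q_def using P' P'P'
    by (subst mult_four_block_mat[of _ 1 1 _ m _ m _ _ 1 _ m]) auto
  have "transpose_mat Q * B = four_block_mat ?R (0\<^sub>m 1 m) (0\<^sub>m m 1) (transpose_mat P' * B')"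
    unfolding Qt Bblock using P' B'
    by (subst mult_four_block_mat[of _ 1 1 _ m _ m _ _ 1 _ m]) auto
  hence QBQ: "transpose_mat Q * B * Q = D"
    unfolding D_def Q_def using P' B' P'D'
    by (simp, subst mult_four_block_mat[of _ 1 1 _ m _ m _ _ 1 _ m]) (auto simp: left_add_zero_mat[of _ m m])
  have cl: "M * N \<in> carrier_mat ?n ?n" if "M \<in> carrier_mat ?n ?n" "N \<in> carrier_mat ?n ?n"
    for M N :: "real mat" using that by simp
  note as = assoc_mult_mat[of _ ?n ?n _ ?n _ ?n]
  have Qtc: "transpose_mat Q \<in> carrier_mat ?n ?n" using Q by simp
  have Pt: "transpose_mat (H * Q) = transpose_mat Q * H"
    using H Q Ht by (simp add: transpose_mult[of _ ?n ?n])
  have "transpose_mat (H * Q) * (H * Q) = transpose_mat Q * ((H * H) * Q)"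
    unfolding Pt using H Q Qtc by (simp add: as cl)
  also have "\<dots> = 1\<^sub>m ?n" using HH Q QQ by simp
  finally have PP: "transpose_mat (H * Q) * (H * Q) = 1\<^sub>m ?n" .
  have PAP: "transpose_mat (H * Q) * A * (H * Q) = D"
    unfolding Pt QBQ[symmetric] B_def using H Q Qtc A by (simp add: as cl)
  have "D $$ (i,j) = 0" if "i < ?n" "j < ?n" "i \<noteq> j" for i j
    using that D' diag[of "i - 1" "j - 1"] by (auto simp: D_def)
  thus ?case using cl[OF H Q] D PP PAP by blast
qed

section \<open>A lower bound for the second largest eigenvalue\<close>

lemma diagonalised_bilinear_form:
  fixes A :: "real mat"
  assumes A: "A \<in> carrier_mat n n" and P: "P \<in> carrier_mat n n" and D: "D \<in> carrier_mat n n"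
    and PP: "transpose_mat P * P = 1\<^sub>m n" and PAP: "transpose_mat P * A * P = D"
    and diag: "\<forall>i<n. \<forall>j<n. i \<noteq> j \<longrightarrow> D $$ (i,j) = 0"
    and x: "x \<in> carrier_vec n" and y: "y \<in> carrier_vec n"
  shows "x \<bullet> (A *\<^sub>v y) = (\<Sum>i<n. D $$ (i,i) * (transpose_mat P *\<^sub>v x) $ i * (transpose_mat P *\<^sub>v y) $ i)"
    and "x \<bullet> y = (\<Sum>i<n. (transpose_mat P *\<^sub>v x) $ i * (transpose_mat P *\<^sub>v y) $ i)"
proof -
  let ?T = "transpose_mat P"
  have T: "?T \<in> carrier_mat n n" using P by simp
  have PT: "P * ?T = 1\<^sub>m n" by (rule mat_mult_left_right_inverse[OF T P PP])
  have adj: "x \<bullet> (P *\<^sub>v w) = (?T *\<^sub>v x) \<bullet> w" if "w \<in> carrier_vec n" for w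
    using transpose_vec_mult_scalar[OF P that x] by simp
  have cancel: "P *\<^sub>v (?T *\<^sub>v w) = w" if "w \<in> carrier_vec n" for w
    using that PT P T by (simp add: assoc_mult_mat_vec[symmetric, of _ n n _ n])
  have "x \<bullet> y = x \<bullet> (P *\<^sub>v (?T *\<^sub>v y))" by (simp add: cancel y)
  also have "\<dots> = (?T *\<^sub>v x) \<bullet> (?T *\<^sub>v y)" using T y by (intro adj) auto
  finally show "x \<bullet> y = (\<Sum>i<n. (?T *\<^sub>v x) $ i * (?T *\<^sub>v y) $ i)"
    using P by (simp add: scalar_prod_def lessThan_atLeast0)
  have "x \<bullet> (A *\<^sub>v y) = x \<bullet> (P *\<^sub>v (?T *\<^sub>v (A *\<^sub>v y)))"
    using A y by (subst cancel) auto
  also have "\<dots> = (?T *\<^sub>v x) \<bullet> (?T *\<^sub>v (A *\<^sub>v y))"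
    using T A y by (intro adj) auto
  also have "?T *\<^sub>v (A *\<^sub>v y) = ?T *\<^sub>v (A *\<^sub>v (P *\<^sub>v (?T *\<^sub>v y)))" by (simp add: cancel y)
  also have "\<dots> = D *\<^sub>v (?T *\<^sub>v y)"
    unfolding PAP[symmetric] using T A P y
    by (simp add: assoc_mult_mat_vec[of _ n n _ n] assoc_mult_mat[of _ n n _ n _ n])
  finally have "x \<bullet> (A *\<^sub>v y) = (\<Sum>i<n. (?T *\<^sub>v x) $ i * (\<Sum>j<n. D $$ (i,j) * (?T *\<^sub>v y) $ j))"
    using P D by (simp add: scalar_prod_def lessThan_atLeast0)
  also have "\<dots> = (\<Sum>i<n. (?T *\<^sub>v x) $ i * (\<Sum>j<n. if j = i then D $$ (i,i) * (?T *\<^sub>v y) $ i else 0))"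
    using diag by (intro sum.cong refl arg_cong2[of _ _ _ _ "(*)"]) auto
  also have "\<dots> = (\<Sum>i<n. D $$ (i,i) * (?T *\<^sub>v x) $ i * (?T *\<^sub>v y) $ i)"
    by (intro sum.cong) auto
  finally show "x \<bullet> (A *\<^sub>v y) = (\<Sum>i<n. D $$ (i,i) * (?T *\<^sub>v x) $ i * (?T *\<^sub>v y) $ i)" .
qed

lemma at_most_one_entry_above_second_largest:
  fixes ds :: "real list"
  assumes second: "rev (sort ds) ! 1 \<le> t" and "i < length ds" "j < length ds" "i \<noteq> j"
    and "ds ! i > t"
  shows "ds ! j \<le> t"
proof (rule ccontr)
  assume j: "\<not> ds ! j \<le> t"
  let ?L = "rev (sort ds)"
  have le: "?L ! l \<le> t" if "1 \<le> l" "l < length ds" for l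
  proof -
    have "?L ! l \<le> ?L ! 1"
      using sorted_rev_nth_mono[of ?L 1 l] that by simp
    thus ?thesis using second by linarith
  qed
  have "l = 0" if "l < length ?L" "?L ! l > t" for l
  proof (rule ccontr)
    assume "l \<noteq> 0"
    with le[of l] that show False by simp
  qed
  hence "{l. l < length ?L \<and> ?L ! l > t} \<subseteq> {0}" by blast
  from card_mono[OF _ this] have "card {l. l < length ?L \<and> ?L ! l > t} \<le> 1" by simp
  hence "length (filter (\<lambda>x. x > t) ?L) \<le> 1" by (simp add: length_filter_conv_card)
  moreover have "length (filter (\<lambda>x. x > t) ?L) = length (filter (\<lambda>x. x > t) ds)"
  proof -
    have "mset (filter (\<lambda>x. x > t) ?L) = mset (filter (\<lambda>x. x > t) ds)" by simp
    thus ?thesis by (rule mset_eq_length)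
  qed
  moreover have "card {i, j} \<le> card {l. l < length ds \<and> ds ! l > t}"
    using assms j by (intro card_mono) auto
  ultimately show False using \<open>i \<noteq> j\<close> by (simp add: length_filter_conv_card)
qed

text \<open>
  This is the half of the Courant-Fischer principle for the second eigenvalue that test vectors
  provide. If at most one member of an orthonormal eigenbasis had an eigenvalue above \<open>t\<close>, the plane
  spanned by \<open>f\<close> and \<open>g\<close> would contain a nonzero vector \<open>w\<close> orthogonal to it, and the quadratic form
  \<open>w \<bullet> A w - t * (w \<bullet> w)\<close> would be at most zero there. The form is however positive on the whole
  plane except at zero, as it is positive at \<open>f\<close> and at \<open>g\<close> and the cross terms vanish.
\<close>

lemma second_largest_root_of_char_poly_gt:
  fixes A :: "real mat"
  assumes A: "A \<in> carrier_mat n n" and sym: "transpose_mat A = A"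
    and f: "f \<in> carrier_vec n" and g: "g \<in> carrier_vec n"
    and orth: "f \<bullet> g = 0" "f \<bullet> (A *\<^sub>v g) = 0"
    and ff: "f \<bullet> (A *\<^sub>v f) > t * (f \<bullet> f)" and gg: "g \<bullet> (A *\<^sub>v g) > t * (g \<bullet> g)"
  shows "rev (sorted_list_of_multiset (proots (char_poly A))) ! 1 > t"
proof (rule ccontr)
  obtain P D where P: "P \<in> carrier_mat n n" and D: "D \<in> carrier_mat n n"
    and PP: "transpose_mat P * P = 1\<^sub>m n" and PAP: "transpose_mat P * A * P = D"
    and diag: "\<forall>i<n. \<forall>j<n. i \<noteq> j \<longrightarrow> D $$ (i,j) = 0"
    using symmetric_mat_orthogonally_diagonalisable[OF A sym] by blast
  let ?T = "transpose_mat P"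
  let ?ds = "diag_mat D"
  have len: "length ?ds = n" and ds: "\<And>i. i < n \<Longrightarrow> ?ds ! i = D $$ (i,i)"
    using D by (auto simp: diag_mat_def)
  have T: "?T \<in> carrier_mat n n" using P by simp
  have "similar_mat_wit D A ?T P"
    by (rule similar_mat_witI[OF PP mat_mult_left_right_inverse[OF T P PP]])
      (use PAP A D P T in auto)
  hence "char_poly A = char_poly D"
    using char_poly_similar[of D A] unfolding similar_mat_def by metis
  also have "\<dots> = (\<Prod>a\<leftarrow>?ds. [:- a, 1:])"
    by (rule char_poly_upper_triangular[OF D]) (use D diag in auto)
  finally have cp: "char_poly A = (\<Prod>a\<leftarrow>?ds. [:- a, 1:])" .
  have "proots (\<Prod>a\<leftarrow>as. [:- a, 1:]) = mset as" for as :: "real list"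
    by (induction as) (simp_all add: proots_mult prod_list_zero_iff image_iff del: mult_pCons_left)
  hence "proots (char_poly A) = mset ?ds" unfolding cp by simp
  hence roots: "rev (sorted_list_of_multiset (proots (char_poly A))) = rev (sort ?ds)"
    by simp
  assume "\<not> ?thesis"
  hence second: "rev (sort ?ds) ! 1 \<le> t" unfolding roots by simp
  have "n > 0" using ff f by (cases n) (auto simp: scalar_prod_def)
  obtain m where m: "m < n" "\<And>i. i < n \<Longrightarrow> i \<noteq> m \<Longrightarrow> D $$ (i,i) \<le> t"
  proof (cases "\<exists>i<n. D $$ (i,i) > t")
    case True
    then obtain i where i: "i < n" "D $$ (i,i) > t" by blast
    show ?thesis
      by (rule that[OF i(1)])
        (use at_most_one_entry_above_second_largest[OF second, of i] len ds i in auto)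
  next
    case False
    thus ?thesis using that[OF \<open>n > 0\<close>] by force
  qed
  note bil = diagonalised_bilinear_form[OF A P D PP PAP diag]
  define y where "y = (\<lambda>i. (?T *\<^sub>v f) $ i)"
  define z where "z = (\<lambda>i. (?T *\<^sub>v g) $ i)"
  define d where "d = (\<lambda>i. D $$ (i,i) - t)"
  have yy: "(\<Sum>i<n. d i * y i * y i) > 0"
    using ff unfolding bil(1)[OF f f] bil(2)[OF f f]
    by (simp add: y_def d_def algebra_simps sum_subtractf sum_distrib_left)
  have zz: "(\<Sum>i<n. d i * z i * z i) > 0"
    using gg unfolding bil(1)[OF g g] bil(2)[OF g g]
    by (simp add: z_def d_def algebra_simps sum_subtractf sum_distrib_left)
  have "(\<Sum>i<n. d i * y i * z i) = f \<bullet> (A *\<^sub>v g) - t * (f \<bullet> g)"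
    unfolding bil(1)[OF f g] bil(2)[OF f g]
    by (simp add: y_def z_def d_def algebra_simps sum_subtractf sum_distrib_left)
  hence yz: "(\<Sum>i<n. d i * y i * z i) = 0" by (simp add: orth)
  \<comment> \<open>The vector \<open>\<alpha> f + \<beta> g\<close> has no component along the \<open>m\<close>-th eigenvector.\<close>
  obtain \<alpha> \<beta> where ab: "\<alpha> * y m + \<beta> * z m = 0" "\<alpha> \<noteq> 0 \<or> \<beta> \<noteq> 0"
  proof (cases "y m = 0")
    case True
    thus ?thesis using that[of 1 0] by simp
  next
    case False
    thus ?thesis using that[of "z m" "- y m"] by simp
  qed
  have "(\<Sum>i<n. d i * (\<alpha> * y i + \<beta> * z i)\<^sup>2)
      = (\<Sum>i<n. \<alpha>\<^sup>2 * (d i * y i * y i) + \<beta>\<^sup>2 * (d i * z i * z i) + 2 * \<alpha> * \<beta> * (d i * y i * z i))"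
    by (intro sum.cong) (auto simp: power2_eq_square algebra_simps)
  also have "\<dots> = \<alpha>\<^sup>2 * (\<Sum>i<n. d i * y i * y i) + \<beta>\<^sup>2 * (\<Sum>i<n. d i * z i * z i)"
    unfolding sum.distrib sum_distrib_left[symmetric] yz by simp
  also have "\<dots> > 0"
    using yy zz ab(2) by (auto simp: add_pos_nonneg add_nonneg_pos less_imp_le)
  finally have "(\<Sum>i<n. d i * (\<alpha> * y i + \<beta> * z i)\<^sup>2) > 0" .
  moreover have "d i * (\<alpha> * y i + \<beta> * z i)\<^sup>2 \<le> 0" if "i < n" for i
    using m(2)[OF that] ab(1) by (cases "i = m") (auto simp: d_def mult_nonpos_nonneg)
  hence "(\<Sum>i<n. d i * (\<alpha> * y i + \<beta> * z i)\<^sup>2) \<le> 0" by (intro sum_nonpos) auto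
  ultimately show False by simp
qed

definition edge_ind :: "('v, 'e) pre_digraph \<Rightarrow> 'v \<Rightarrow> 'v \<Rightarrow> real" where
  "edge_ind G u v = (if u \<rightarrow>\<^bsub>G\<^esub> v then 1 else 0)"

text \<open>
  The previous bound in terms of functions on the vertices, which frees it from the enumeration of
  the vertices used to form the adjacency matrix.
\<close>

lemma second_adjacency_eigenvalue_gt:
  fixes f g :: "'v \<Rightarrow> real"
  assumes fin: "finite (verts G)" and sym: "symmetric G"
    and orth: "(\<Sum>u\<in>verts G. f u * g u) = 0"
      "(\<Sum>u\<in>verts G. \<Sum>v\<in>verts G. edge_ind G u v * (f u * g v)) = 0"
    and ff: "(\<Sum>u\<in>verts G. \<Sum>v\<in>verts G. edge_ind G u v * (f u * f v)) > t * (\<Sum>u\<in>verts G. f u * f u)"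
    and gg: "(\<Sum>u\<in>verts G. \<Sum>v\<in>verts G. edge_ind G u v * (g u * g v)) > t * (\<Sum>u\<in>verts G. g u * g u)"
  shows "adjacency_eigenvalue G 2 > t"
proof -
  define vs where "vs = (SOME vs. distinct vs \<and> set vs = verts G)"
  have "\<exists>vs. distinct vs \<and> set vs = verts G" using finite_distinct_list[OF fin] by blast
  hence vs: "distinct vs" "set vs = verts G" unfolding vs_def by (metis (mono_tags, lifting) someI_ex)+
  define n where "n = length vs"
  define A where "A = adjacency_matrix G vs"
  have A: "A \<in> carrier_mat n n" by (simp add: A_def adjacency_matrix_def n_def)
  have ent: "A $$ (i,j) = edge_ind G (vs ! i) (vs ! j)" if "i < n" "j < n" for i j
    using that by (simp add: A_def adjacency_matrix_def n_def edge_ind_def)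
  have "edge_ind G u v = edge_ind G v u" for u v
    using arcs_ends_symmetric[OF sym] by (auto simp: edge_ind_def)
  hence At: "transpose_mat A = A" by (intro eq_matI) (use A ent in auto)
  let ?v = "\<lambda>h. vec n (\<lambda>i. h (vs ! i))"
  have reindex: "(\<Sum>i<n. h (vs ! i)) = (\<Sum>u\<in>verts G. h u)" for h :: "'v \<Rightarrow> real"
    using sum.reindex_bij_betw[OF bij_betw_nth[OF vs(1) refl refl], of h] vs(2)
    by (simp add: n_def)
  have sp: "?v h \<bullet> ?v h' = (\<Sum>u\<in>verts G. h u * h' u)" for h h' :: "'v \<Rightarrow> real"
    using reindex[of "\<lambda>u. h u * h' u"] by (simp add: scalar_prod_def lessThan_atLeast0)
  have qf: "?v h \<bullet> (A *\<^sub>v ?v h') = (\<Sum>u\<in>verts G. \<Sum>v\<in>verts G. edge_ind G u v * (h u * h' v))" for h h' :: "'v \<Rightarrow> real"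
  proof -
    have "?v h \<bullet> (A *\<^sub>v ?v h') = (\<Sum>i<n. \<Sum>j<n. edge_ind G (vs ! i) (vs ! j) * (h (vs ! i) * h' (vs ! j)))"
      using A by (auto simp: scalar_prod_def lessThan_atLeast0 ent sum_distrib_left mult_ac intro!: sum.cong)
    also have "\<dots> = (\<Sum>i<n. \<Sum>v\<in>verts G. edge_ind G (vs ! i) v * (h (vs ! i) * h' v))"
      by (intro sum.cong refl reindex[of "\<lambda>v. edge_ind G _ v * (h _ * h' v)"])
    also have "\<dots> = (\<Sum>u\<in>verts G. \<Sum>v\<in>verts G. edge_ind G u v * (h u * h' v))"
      by (rule reindex[of "\<lambda>u. \<Sum>v\<in>verts G. edge_ind G u v * (h u * h' v)"])
    finally show ?thesis .
  qed
  have "rev (sorted_list_of_multiset (proots (char_poly A))) ! 1 > t"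
    by (rule second_largest_root_of_char_poly_gt[OF A At, of "?v f" "?v g"])
      (use orth ff gg in \<open>simp_all add: sp qf\<close>)
  thus ?thesis
    by (simp add: adjacency_eigenvalue_def adjacency_eigenvalues_def A_def vs_def Let_def)
qed

text \<open>
  The restrictions of \<open>z\<close> to \<open>A\<close> and to \<open>B\<close> have disjoint supports, and no edge joins the supports, so
  they are orthogonal for the scalar product and for the quadratic form of the graph alike.
\<close>

lemma second_adjacency_eigenvalue_gt_of_separated_sets:
  fixes z :: "'v \<Rightarrow> real"
  assumes fin: "finite (verts G)" and sym: "symmetric G"
    and AB: "A \<subseteq> verts G" "B \<subseteq> verts G" "A \<inter> B = {}"
    and sep: "\<forall>u\<in>A. \<forall>v\<in>B. \<not> u \<rightarrow>\<^bsub>G\<^esub> v"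
    and A: "(\<Sum>u\<in>A. \<Sum>v\<in>A. edge_ind G u v * (z u * z v)) > t * (\<Sum>u\<in>A. z u * z u)"
    and B: "(\<Sum>u\<in>B. \<Sum>v\<in>B. edge_ind G u v * (z u * z v)) > t * (\<Sum>u\<in>B. z u * z u)"
  shows "adjacency_eigenvalue G 2 > t"
proof -
  let ?r = "\<lambda>C u. if u \<in> C then z u else 0"
  have quad: "(\<Sum>u\<in>verts G. \<Sum>v\<in>verts G. edge_ind G u v * (?r C u * ?r D v))
      = (\<Sum>u\<in>C. \<Sum>v\<in>D. edge_ind G u v * (z u * z v))" if "C \<subseteq> verts G" "D \<subseteq> verts G" for C D
  proof -
    have "(\<Sum>v\<in>verts G. edge_ind G u v * (?r C u * ?r D v)) = (if u \<in> C then \<Sum>v\<in>D. edge_ind G u v * (z u * z v) else 0)" for u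
      using sum.mono_neutral_cong_right[OF fin that(2), of "\<lambda>v. edge_ind G u v * (?r C u * ?r D v)"
          "\<lambda>v. edge_ind G u v * (z u * z v)"] by auto
    thus ?thesis by (simp add: sum.inter_restrict[OF fin, symmetric] Int_absorb1[OF that(1)])
  qed
  have sq: "(\<Sum>u\<in>verts G. ?r C u * ?r C u) = (\<Sum>u\<in>C. z u * z u)" if "C \<subseteq> verts G" for C
    by (rule sum.mono_neutral_cong_right[OF fin that]) auto
  have "(\<Sum>u\<in>verts G. ?r A u * ?r B u) = 0"
    using AB(3) by (intro sum.neutral) auto
  moreover have "(\<Sum>u\<in>A. \<Sum>v\<in>B. edge_ind G u v * (z u * z v)) = 0"
    using sep by (intro sum.neutral ballI) (auto simp: edge_ind_def)
  ultimately show ?thesis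
    using second_adjacency_eigenvalue_gt[OF fin sym, of "?r A" "?r B" t] A B AB
    by (simp only: quad sq)
qed

section \<open>Edge counts in the separated parts of a biregular graph\<close>

text \<open>
  One side consists of the vertices that some fixed vertex reaches outside \<open>S\<close>.
\<close>

lemma separating_set_splits:
  assumes "graph G" and "separating_set G S"
  obtains A B where "A \<union> B = verts G - S" "A \<inter> B = {}" "A \<noteq> {}" "B \<noteq> {}"
    "\<forall>u\<in>A. \<forall>v\<in>B. \<not> u \<rightarrow>\<^bsub>G\<^esub> v"
proof -
  interpret graph G by fact
  let ?H = "G \<restriction> (verts G - S)"
  let ?M = "mk_symmetric ?H"
  interpret H: wf_digraph ?H by (rule wellformed_induce_subgraph)
  interpret M: pair_wf_digraph ?M by (rule H.wellformed_mk_symmetric)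
  have "\<not> strongly_connected ?M" and S: "S \<subset> verts G"
    using assms(2) unfolding separating_set_def Digraph_Component.connected_def by auto
  then obtain u v where uv: "u \<in> verts G - S" "v \<in> verts G - S" "\<not> u \<rightarrow>\<^sup>*\<^bsub>with_proj ?M\<^esub> v"
    unfolding strongly_connected_def by auto
  define A where "A = {w \<in> verts G - S. u \<rightarrow>\<^sup>*\<^bsub>with_proj ?M\<^esub> w}"
  show ?thesis
  proof (rule that[of A "verts G - S - A"])
    have "u \<rightarrow>\<^sup>*\<^bsub>with_proj ?M\<^esub> u" using uv by (intro M.reachable_refl) simp
    thus "A \<noteq> {}" using uv by (auto simp: A_def)
    show "verts G - S - A \<noteq> {}" using uv by (auto simp: A_def)
    show "\<forall>w\<in>A. \<forall>x\<in>verts G - S - A. \<not> w \<rightarrow>\<^bsub>G\<^esub> x"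
    proof (intro ballI notI)
      fix w x assume w: "w \<in> A" and x: "x \<in> verts G - S - A"
      assume "w \<rightarrow>\<^bsub>G\<^esub> x"
      then obtain e where e: "e \<in> arcs G" "w = tail G e" "x = head G e" unfolding arcs_ends_conv by blast
      hence "e \<in> arcs ?H" using w x by (simp add: A_def)
      hence "(w, x) \<in> parcs ?M" unfolding parcs_mk_symmetric by (rule UN_I) (simp add: e)
      hence "w \<rightarrow>\<^bsub>with_proj ?M\<^esub> x" by simp
      with w have "u \<rightarrow>\<^sup>*\<^bsub>with_proj ?M\<^esub> x"
        unfolding A_def by (blast intro: wf_digraph.reachable_adj_trans[OF M.wf_digraph])
      thus False using x unfolding A_def by blast
    qed
  qed (auto simp: A_def)
qed

lemma biregular_graph_swap: "biregular_graph G X Y a b \<Longrightarrow> biregular_graph G Y X b a"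
  unfolding biregular_graph_def by (auto simp: Un_commute Int_commute)

text \<open>
  The hypotheses on \<open>A\<close> say that it is a union of components of \<open>G - S\<close>, so the \<open>a\<close> neighbours of \<open>x\<close>
  all lie in \<open>A\<close> or in \<open>S\<close>.
\<close>

lemma biregular_degree_split:
  assumes G: "biregular_graph G X Y a b" and S: "S \<subseteq> verts G" and A: "A \<subseteq> verts G - S"
    and closed: "\<forall>u\<in>A. \<forall>v. u \<rightarrow>\<^bsub>G\<^esub> v \<longrightarrow> v \<in> A \<union> S" and x: "x \<in> A \<inter> X"
  shows "real a = (\<Sum>v\<in>A \<inter> Y. edge_ind G x v) + (\<Sum>v\<in>S \<inter> Y. edge_ind G x v)"
proof -
  interpret graph G using G by (simp add: biregular_graph_def)
  have "inj_on (head G) (out_arcs G x)"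
    by (rule inj_onI) (auto intro!: no_multi_arcs simp: arc_to_ends_def)
  hence "card (out_arcs G x) = card (head G ` out_arcs G x)" by (simp add: card_image)
  also have "head G ` out_arcs G x = {v \<in> verts G. x \<rightarrow>\<^bsub>G\<^esub> v}"
    by (auto simp: arcs_ends_conv)
  finally have "real a = real (card {v \<in> verts G. x \<rightarrow>\<^bsub>G\<^esub> v})"
    using G x by (auto simp: biregular_graph_def out_degree_def)
  also have "\<dots> = (\<Sum>v\<in>verts G. edge_ind G x v)"
    by (simp add: edge_ind_def sum.If_cases Int_def)
  also have "\<dots> = (\<Sum>v\<in>A \<inter> Y \<union> S \<inter> Y. edge_ind G x v)"
  proof (rule sum.mono_neutral_right)
    show "A \<inter> Y \<union> S \<inter> Y \<subseteq> verts G" using S A by auto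
    have "v \<in> Y \<and> v \<in> A \<union> S" if "x \<rightarrow>\<^bsub>G\<^esub> v" for v
      using that closed x G unfolding biregular_graph_def by blast
    thus "\<forall>v\<in>verts G - (A \<inter> Y \<union> S \<inter> Y). edge_ind G x v = 0"
      by (auto simp: edge_ind_def)
  qed simp
  also have "\<dots> = (\<Sum>v\<in>A \<inter> Y. edge_ind G x v) + (\<Sum>v\<in>S \<inter> Y. edge_ind G x v)"
    using A S by (intro sum.union_disjoint) (auto intro: finite_subset[OF _ finite_verts])
  finally show ?thesis .
qed

lemma biregular_edges_to_separator_le:
  assumes G: "biregular_graph G X Y a b" and S: "S \<subseteq> verts G" and A: "A \<subseteq> verts G - S"
  shows "(\<Sum>x\<in>A \<inter> X. \<Sum>v\<in>S \<inter> Y. edge_ind G x v) \<le> real b * card (S \<inter> Y)"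
proof -
  interpret graph G using G by (simp add: biregular_graph_def)
  have fin: "finite C" if "C \<subseteq> verts G" for C using that finite_subset[OF _ finite_verts] by blast
  have "(\<Sum>x\<in>A \<inter> X. edge_ind G x v) \<le> real b" if v: "v \<in> S \<inter> Y" for v
  proof -
    have "(\<Sum>x\<in>A \<inter> X. edge_ind G x v) \<le> (\<Sum>x\<in>verts G \<inter> X. edge_ind G x v)"
      using A by (intro sum_mono2) (auto simp: edge_ind_def intro: fin)
    also have "\<dots> = (\<Sum>x\<in>verts G \<inter> X. edge_ind G v x)"
      using arcs_ends_symmetric[OF sym_arcs] by (intro sum.cong) (auto simp: edge_ind_def)
    also have "\<dots> = real b"
      using biregular_degree_split[OF biregular_graph_swap[OF G], of "{}" "verts G" v] v S
      by (auto simp: adj_in_verts)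
    finally show ?thesis .
  qed
  hence "(\<Sum>v\<in>S \<inter> Y. \<Sum>x\<in>A \<inter> X. edge_ind G x v) \<le> (\<Sum>v\<in>S \<inter> Y. real b)" by (rule sum_mono)
  thus ?thesis by (subst sum.swap) (simp add: mult.commute)
qed

text \<open>
  These are the estimates obtained from the vertices of \<open>A\<close> in one class of the bipartition: each of
  them has \<open>a\<close> neighbours, of which at most \<open>|S \<inter> Y|\<close> lie outside \<open>A\<close>. Exchanging \<open>X\<close> and \<open>Y\<close> covers
  the other class.
\<close>

lemma biregular_separated_part_one_side:
  assumes G: "biregular_graph G X Y a b" and S: "S \<subseteq> verts G" and A: "A \<subseteq> verts G - S"
    and closed: "\<forall>u\<in>A. \<forall>v. u \<rightarrow>\<^bsub>G\<^esub> v \<longrightarrow> v \<in> A \<union> S"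
  defines "e \<equiv> (\<Sum>x\<in>A \<inter> X. \<Sum>y\<in>A \<inter> Y. edge_ind G x y)"
  shows "real a * card (A \<inter> X) \<ge> e"
    and "real a * card (A \<inter> X) \<le> e + real b * card (S \<inter> Y)"
    and "(real a - card (S \<inter> Y)) * card (A \<inter> X) \<le> e"
    and "A \<inter> X \<noteq> {} \<Longrightarrow> real a - card (S \<inter> Y) \<le> card (A \<inter> Y)"
proof -
  interpret graph G using G by (simp add: biregular_graph_def)
  note deg = biregular_degree_split[OF G S A closed]
  have ind: "0 \<le> edge_ind G u v" "edge_ind G u v \<le> 1" for u v by (auto simp: edge_ind_def)
  let ?d = "\<lambda>x. \<Sum>y\<in>A \<inter> Y. edge_ind G x y" and ?s = "\<lambda>x. \<Sum>y\<in>S \<inter> Y. edge_ind G x y"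
  have "real a * card (A \<inter> X) = (\<Sum>x\<in>A \<inter> X. ?d x + ?s x)"
    by (subst sum.cong[OF refl deg[symmetric]]) auto
  hence total: "real a * card (A \<inter> X) = e + (\<Sum>x\<in>A \<inter> X. ?s x)"
    by (simp add: sum.distrib e_def)
  have "(\<Sum>x\<in>A \<inter> X. ?s x) \<ge> 0" using ind by (intro sum_nonneg)
  thus "real a * card (A \<inter> X) \<ge> e" using total by simp
  show "real a * card (A \<inter> X) \<le> e + real b * card (S \<inter> Y)"
    using total biregular_edges_to_separator_le[OF G S A] by simp
  have low: "real a - card (S \<inter> Y) \<le> ?d x" if "x \<in> A \<inter> X" for x
  proof -
    have "?s x \<le> (\<Sum>y\<in>S \<inter> Y. 1)" using ind by (intro sum_mono)
    thus ?thesis using deg[OF that] by simp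
  qed
  have "(\<Sum>x\<in>A \<inter> X. real a - card (S \<inter> Y)) \<le> e" unfolding e_def using low by (rule sum_mono)
  thus "(real a - card (S \<inter> Y)) * card (A \<inter> X) \<le> e" by (simp add: mult.commute)
  assume "A \<inter> X \<noteq> {}"
  then obtain x where x: "x \<in> A \<inter> X" by blast
  have "?d x \<le> (\<Sum>y\<in>A \<inter> Y. 1)" using ind by (intro sum_mono)
  thus "real a - card (S \<inter> Y) \<le> card (A \<inter> Y)" using low[OF x] by simp
qed

text \<open>
  The weight \<open>a * |A \<inter> X| + b * |A \<inter> Y|\<close> counts each edge inside \<open>A\<close> twice and each edge from \<open>A\<close> to
  \<open>S\<close> once, and there are at most \<open>c\<close> edges of the second kind. For the lower bound on \<open>e\<close>, a vertex
  of \<open>A\<close> keeps a neighbour in \<open>A\<close> because its degree exceeds \<open>card S\<close>; so \<open>A\<close> meets both classes,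
  and then \<open>e \<ge> (a - |S \<inter> Y|) * (b - |S \<inter> X|) \<ge> a * b - c\<close>.
\<close>

lemma biregular_separated_part:
  assumes G: "biregular_graph G X Y a b" and S: "S \<subseteq> verts G" and A: "A \<subseteq> verts G - S"
    and closed: "\<forall>u\<in>A. \<forall>v. u \<rightarrow>\<^bsub>G\<^esub> v \<longrightarrow> v \<in> A \<union> S" and "A \<noteq> {}"
    and k: "card S < k" "k \<le> a" "k \<le> b"
  defines "e \<equiv> (\<Sum>x\<in>A \<inter> X. \<Sum>y\<in>A \<inter> Y. edge_ind G x y)"
    and "c \<equiv> (real k - 1) * real (max a b)"
  shows "2 * e \<le> real a * card (A \<inter> X) + real b * card (A \<inter> Y)"
    and "real a * card (A \<inter> X) + real b * card (A \<inter> Y) \<le> 2 * e + c"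
    and "real a * real b - c \<le> e"
proof -
  interpret graph G using G by (simp add: biregular_graph_def)
  let ?sX = "real (card (S \<inter> X))" and ?sY = "real (card (S \<inter> Y))"
  have "finite S" using finite_subset[OF S finite_verts] .
  moreover have XY: "X \<union> Y = verts G" "X \<inter> Y = {}" using G by (auto simp: biregular_graph_def)
  hence "S = (S \<inter> X) \<union> (S \<inter> Y)" using S by auto
  ultimately have cS: "card S = card (S \<inter> X) + card (S \<inter> Y)"
    using XY by (metis (no_types, lifting) card_Un_disjoint finite_Int inf_assoc inf_bot_right inf_commute)
  hence s: "?sX + ?sY \<le> real k - 1" using k(1) by linarith
  have "edge_ind G u v = edge_ind G v u" for u v
    using arcs_ends_symmetric[OF sym_arcs] by (auto simp: edge_ind_def)
  hence e': "(\<Sum>y\<in>A \<inter> Y. \<Sum>x\<in>A \<inter> X. edge_ind G y x) = e"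
    unfolding e_def by (subst sum.swap) simp
  note one = biregular_separated_part_one_side[OF G S A closed, folded e_def]
  note two = biregular_separated_part_one_side[OF biregular_graph_swap[OF G] S A closed, unfolded e']
  have "real a * ?sX + real b * ?sY \<le> real (max a b) * ?sX + real (max a b) * ?sY"
    by (intro add_mono mult_right_mono) auto
  also have "\<dots> = (?sX + ?sY) * real (max a b)" by (simp add: algebra_simps)
  also have "\<dots> \<le> c" unfolding c_def using s by (intro mult_right_mono) auto
  finally have sc: "real a * ?sX + real b * ?sY \<le> c" .
  show "2 * e \<le> real a * card (A \<inter> X) + real b * card (A \<inter> Y)" using one(1) two(1) by simp
  show "real a * card (A \<inter> X) + real b * card (A \<inter> Y) \<le> 2 * e + c"
    using one(2) two(2) sc by simp
  have pos: "real a - ?sY > 0" "real b - ?sX > 0" using k cS by linarith+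
  have "A \<inter> Y \<noteq> {}" if "A \<inter> X \<noteq> {}" using one(4)[OF that] pos by force
  moreover have "A \<inter> X \<noteq> {} \<or> A \<inter> Y \<noteq> {}" using A XY \<open>A \<noteq> {}\<close> by blast
  ultimately have "A \<inter> Y \<noteq> {}" by blast
  hence "real b - ?sX \<le> card (A \<inter> X)" using two(4) by blast
  hence "(real a - ?sY) * (real b - ?sX) \<le> (real a - ?sY) * card (A \<inter> X)"
    using pos by (intro mult_left_mono) auto
  also have "\<dots> \<le> e" using one(3) by simp
  finally have "real a * real b - (real a * ?sX + real b * ?sY) + ?sX * ?sY \<le> e"
    by (simp add: algebra_simps)
  moreover have "?sX * ?sY \<ge> 0" by simp
  ultimately show "real a * real b - c \<le> e" using sc by linarith
qed

section \<open>The Rayleigh quotient of a separated part\<close>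

text \<open>
  Let \<open>q = sqrt p\<close>, \<open>r = sqrt (p - c)\<close> and let \<open>h = q - c / (2 * r)\<close> be the bound. As \<open>c = q\<^sup>2 - r\<^sup>2\<close>,
  the inequality \<open>(q - r)\<^sup>2 > 0\<close> says precisely that \<open>h < r\<close>. With \<open>w = 2 * e + t\<close> the claim reads
  \<open>h * t < 2 * e * (q - h)\<close>, and the right-hand side is at least \<open>2 * r\<^sup>2 * c / (2 * r) = r * c\<close>,
  where \<open>t \<le> c\<close>.
\<close>

lemma rayleigh_bound_arith:
  fixes e w c p :: real
  assumes c: "0 < c" "c < p" and e: "p - c \<le> e" and w: "2 * e \<le> w" "w \<le> 2 * e + c"
  shows "(sqrt p - c / (2 * sqrt (p - c))) * w < 2 * sqrt p * e"
proof -
  define q where "q = sqrt p"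
  define r where "r = sqrt (p - c)"
  define h where "h = q - c / (2 * r)"
  have q: "q * q = p" and r: "r * r = p - c" "r > 0" using c by (auto simp: q_def r_def)
  have cqr: "c = q * q - r * r" using q r by simp
  have "q \<noteq> r" using cqr c by auto
  hence "(q - r) * (q - r) > 0"
    by (metis eq_iff_diff_eq_0 not_square_less_zero mult_eq_0_iff linorder_neqE_linordered_idom)
  hence "2 * r * q - c < 2 * r * r" unfolding cqr by (simp add: algebra_simps)
  hence hr: "h < r" using r(2) by (simp add: h_def field_simps)
  define t where "t = w - 2 * e"
  have t: "0 \<le> t" "t \<le> c" using w by (auto simp: t_def)
  have "h * t < r * c"
  proof (cases "t = 0")
    case True thus ?thesis using r c by simp
  next
    case False
    hence "h * t < r * t" using t hr by simp
    also have "\<dots> \<le> r * c" using t r by simp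
    finally show ?thesis .
  qed
  also have "r * c = (p - c) * (c / r)" using r(2) unfolding r(1)[symmetric] by simp
  also have "\<dots> \<le> e * (c / r)" using e c r by (intro mult_right_mono) auto
  also have "\<dots> = 2 * e * (q - h)" using r by (simp add: h_def)
  finally have "h * w < 2 * q * e" by (simp add: t_def algebra_simps)
  thus ?thesis by (simp add: h_def q_def r_def)
qed

text \<open>
  The function \<open>z\<close> is the eigenvector of the eigenvalue \<open>sqrt (a * b)\<close>. Every edge inside
  \<open>A\<close> joins \<open>X\<close> to \<open>Y\<close> and so contributes \<open>2 * sqrt (a * b)\<close> to the quadratic form, while
  \<open>\<Sum>u\<in>A. z u * z u\<close> is the weight \<open>a * |A \<inter> X| + b * |A \<inter> Y|\<close>.
\<close>

lemma biregular_separated_part_rayleigh: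
  assumes G: "biregular_graph G X Y a b" and S: "S \<subseteq> verts G" and A: "A \<subseteq> verts G - S"
    and closed: "\<forall>u\<in>A. \<forall>v. u \<rightarrow>\<^bsub>G\<^esub> v \<longrightarrow> v \<in> A \<union> S" and "A \<noteq> {}"
    and k: "2 \<le> k" "card S < k" "k \<le> a" "k \<le> b"
  defines "z \<equiv> \<lambda>v. if v \<in> X then sqrt (real a) else sqrt (real b)"
    and "c \<equiv> (real k - 1) * real (max a b)"
  shows "(sqrt (real a * real b) - c / (2 * sqrt (real a * real b - c))) * (\<Sum>u\<in>A. z u * z u)
    < (\<Sum>u\<in>A. \<Sum>v\<in>A. edge_ind G u v * (z u * z v))"
proof -
  interpret graph G using G by (simp add: biregular_graph_def)
  define e where "e = (\<Sum>x\<in>A \<inter> X. \<Sum>y\<in>A \<inter> Y. edge_ind G x y)"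
  let ?w = "real a * card (A \<inter> X) + real b * card (A \<inter> Y)"
  have XY: "X \<union> Y = verts G" "X \<inter> Y = {}" using G by (auto simp: biregular_graph_def)
  have "finite A" using finite_subset[OF _ finite_verts] A by blast
  have split: "sum h A = sum h (A \<inter> X) + sum h (A \<inter> Y)" for h :: "'a \<Rightarrow> real"
  proof -
    have "A = A \<inter> X \<union> A \<inter> Y" using A XY by blast
    hence "sum h A = sum h (A \<inter> X \<union> A \<inter> Y)" by simp
    thus ?thesis using XY \<open>finite A\<close> by (subst (asm) sum.union_disjoint) auto
  qed
  have zX: "z v = sqrt (real a)" if "v \<in> A \<inter> X" for v using that by (simp add: z_def)
  have zY: "z v = sqrt (real b)" if "v \<in> A \<inter> Y" for v using that XY by (auto simp: z_def)
  have w: "(\<Sum>u\<in>A. z u * z u) = ?w"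
    unfolding split by (simp add: zX zY mult.commute)
  have "u \<in> X \<and> v \<in> Y \<or> u \<in> Y \<and> v \<in> X" if "u \<rightarrow>\<^bsub>G\<^esub> v" for u v
    using that G unfolding biregular_graph_def by blast
  hence bip: "edge_ind G u v = 0" if "u \<in> X \<and> v \<in> X \<or> u \<in> Y \<and> v \<in> Y" for u v
    using that XY(2) unfolding edge_ind_def by (metis disjoint_iff)
  have "edge_ind G u v = edge_ind G v u" for u v
    using arcs_ends_symmetric[OF sym_arcs] by (auto simp: edge_ind_def)
  hence e': "(\<Sum>y\<in>A \<inter> Y. \<Sum>x\<in>A \<inter> X. edge_ind G y x) = e"
    unfolding e_def by (subst sum.swap) simp
  have "(\<Sum>v\<in>A. edge_ind G u v * (z u * z v)) = (\<Sum>v\<in>A \<inter> Y. edge_ind G u v) * sqrt (real a * real b)"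
    if "u \<in> A \<inter> X" for u
    unfolding split using that by (simp add: zX zY bip sum_distrib_right real_sqrt_mult)
  moreover have "(\<Sum>v\<in>A. edge_ind G u v * (z u * z v)) = (\<Sum>v\<in>A \<inter> X. edge_ind G u v) * sqrt (real a * real b)"
    if "u \<in> A \<inter> Y" for u
    unfolding split using that by (simp add: zX zY bip sum_distrib_left real_sqrt_mult mult_ac)
  ultimately have q: "(\<Sum>u\<in>A. \<Sum>v\<in>A. edge_ind G u v * (z u * z v)) = 2 * sqrt (real a * real b) * e"
    unfolding split[of "\<lambda>u. \<Sum>v\<in>A. edge_ind G u v * (z u * z v)"]
    by (simp add: sum_distrib_right[symmetric] e_def[symmetric] e')
  have "c < real a * real b"
  proof -
    have "c < real k * real (max a b)"
      unfolding c_def using k by (intro mult_strict_right_mono) auto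
    also have "\<dots> \<le> real (min a b) * real (max a b)" using k by (intro mult_right_mono) auto
    also have "\<dots> = real a * real b" by (simp add: min_def max_def)
    finally show ?thesis .
  qed
  moreover have "0 < c" using k by (simp add: c_def)
  ultimately show ?thesis
    unfolding w q using biregular_separated_part[OF G S A closed \<open>A \<noteq> {}\<close> k(2-4), folded e_def c_def]
    by (intro rayleigh_bound_arith) auto
qed

section \<open>Vertex connectivity\<close>

text \<open>
  This settles the case in which no separating set exists and the vertex connectivity is
  \<open>card (verts G) - 1\<close>.
\<close>

lemma biregular_card_ge:
  assumes G: "biregular_graph G X Y a b"
  shows "a + b \<le> card (verts G)"
proof -
  interpret graph G using G by (simp add: biregular_graph_def)
  have XY: "X \<union> Y = verts G" "X \<inter> Y = {}" "X \<noteq> {}" "Y \<noteq> {}" using G by (auto simp: biregular_graph_def)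
  hence V: "verts G \<inter> X = X" "verts G \<inter> Y = Y" by auto
  have "real a \<le> card Y"
    using biregular_separated_part_one_side(4)[OF G, of "{}" "verts G"] V XY adj_in_verts by auto
  moreover have "real b \<le> card X"
    using biregular_separated_part_one_side(4)[OF biregular_graph_swap[OF G], of "{}" "verts G"] V XY adj_in_verts by auto
  moreover have "card (verts G) = card X + card Y"
    using XY finite_verts by (metis card_Un_disjoint finite_Un)
  ultimately show ?thesis by linarith
qed

theorem theorem2p2:
  fixes G :: "('v, 'e) pre_digraph" and X Y :: "'v set" and a b k :: nat
  assumes "k \<ge> 2"
    and "biregular_graph G X Y a b"
    and "a \<ge> k" and "b \<ge> k"
    and "adjacency_eigenvalue G 2
      \<le> sqrt (real a * real b) -
        (real k - 1) * real (max a b) /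
          (2 * sqrt (real a * real b - (real k - 1) * real (max a b)))"
  shows "vertex_connectivity G \<ge> k"
proof (cases "\<exists>S. separating_set G S")
  case False
  thus ?thesis
    using biregular_card_ge[OF assms(2)] assms(1,3,4) by (simp add: vertex_connectivity_def)
next
  case True
  interpret graph G using assms(2) by (simp add: biregular_graph_def)
  have "card S \<ge> k" if sep: "separating_set G S" for S
  proof (rule ccontr)
    assume "\<not> card S \<ge> k"
    hence k: "card S < k" by simp
    have S: "S \<subseteq> verts G" using sep by (auto simp: separating_set_def)
    obtain A B where AB: "A \<union> B = verts G - S" "A \<inter> B = {}" "A \<noteq> {}" "B \<noteq> {}"
      and no: "\<forall>u\<in>A. \<forall>v\<in>B. \<not> u \<rightarrow>\<^bsub>G\<^esub> v"
      using separating_set_splits[OF graph_axioms sep] by metis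
    have no': "\<forall>u\<in>B. \<forall>v\<in>A. \<not> u \<rightarrow>\<^bsub>G\<^esub> v"
      using no arcs_ends_symmetric[OF sym_arcs] by blast
    have clA: "\<forall>u\<in>A. \<forall>v. u \<rightarrow>\<^bsub>G\<^esub> v \<longrightarrow> v \<in> A \<union> S"
      using no adj_in_verts(2) AB(1) by blast
    have clB: "\<forall>u\<in>B. \<forall>v. u \<rightarrow>\<^bsub>G\<^esub> v \<longrightarrow> v \<in> B \<union> S"
      using no' adj_in_verts(2) AB(1) by blast
    have sub: "A \<subseteq> verts G - S" "B \<subseteq> verts G - S" using AB(1) by auto
    have "adjacency_eigenvalue G 2 > sqrt (real a * real b) - (real k - 1) * real (max a b) /
          (2 * sqrt (real a * real b - (real k - 1) * real (max a b)))"
      using sub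
        biregular_separated_part_rayleigh[OF assms(2) S sub(1) clA AB(3) assms(1) k assms(3,4)]
        biregular_separated_part_rayleigh[OF assms(2) S sub(2) clB AB(4) assms(1) k assms(3,4)]
      by (intro second_adjacency_eigenvalue_gt_of_separated_sets[OF finite_verts sym_arcs _ _ AB(2) no,
            where z = "\<lambda>v. if v \<in> X then sqrt (real a) else sqrt (real b)"]) blast+
    thus False using assms(5) by simp
  qed
  moreover have "\<exists>S. separating_set G S \<and> card S = vertex_connectivity G"
    using True LeastI_ex[of "\<lambda>n. \<exists>S. separating_set G S \<and> card S = n"]
    by (auto simp: vertex_connectivity_def)
  ultimately show ?thesis by metis
qed

end
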